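(* Let $0\le\beta\le1$ and let $H_\beta$ be the Hilbert space of entire functions $f:\mathbb C\to\mathbb C$ with $$\int_{\mathbb C}|f(z)|^2\exp\left(-(1+\beta)x^2-(1-\beta)y^2\right)d\lambda(z)<\infty,\qquad z=x+iy .$$ Let $a(f)=f'$ with domain $\mathrm{dom}(a)=\{f\in H_\beta: f'\in H_\beta\}$, let $a^*$ be its Hilbert space adjoint on $H_\beta$, and for $w\in\mathbb C$ let $k_w\in H_\beta$ be the normalized reproducing kernel of $H_\beta$ at $w$. Then for every $w\in\mathbb C$ one has $k_w\in\mathrm{dom}(a)$, the Berezin transform $\tilde a(w)=(a(k_w),k_w)_\beta$ of $a$ is $$\tilde a(w)=\beta w+\overline w ,$$ and the Berezin transform $\widetilde{a^*}(w)=(a^*(k_w),k_w)_\beta$ of $a^*$ is $$\widetilde{a^*}(w)=\overline{\tilde a(w)} .$$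
   Context: $d\lambda$ is Lebesgue measure on $\mathbb C$. The inner product on $H_\beta$ is $(f,g)_\beta=\int_{\mathbb C}f(z)\overline{g(z)}\exp(-(1+\beta)x^2-(1-\beta)y^2)\,d\lambda(z)$. Point evaluations are bounded on $H_\beta$; the Bergman (reproducing) kernel $K_\beta(z,w)$ is determined by $K_\beta(\cdot,w)\in H_\beta$ and $f(w)=(f,K_\beta(\cdot,w))_\beta$ for all $f\in H_\beta$, $w\in\mathbb C$. The normalized kernel is $k_w(z)=K_\beta(z,w)/\sqrt{K_\beta(w,w)}$. The Berezin transform of an operator $T$ on $H_\beta$ with all $k_w\in\mathrm{dom}(T)$ is the function $\tilde T(w)=(T(k_w),k_w)_\beta$. *)

theory Defs
  imports "HOL-Complex_Analysis.Complex_Analysis"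
begin

definition weight :: "real \<Rightarrow> complex \<Rightarrow> real" where
  "weight \<beta> z = exp (- (1 + \<beta>) * (Re z)\<^sup>2 - (1 - \<beta>) * (Im z)\<^sup>2)"

definition H :: "real \<Rightarrow> (complex \<Rightarrow> complex) set" where
  "H \<beta> = {f. f holomorphic_on UNIV \<and>
              integrable lborel (\<lambda>z. (cmod (f z))\<^sup>2 * weight \<beta> z)}"

definition ip :: "real \<Rightarrow> (complex \<Rightarrow> complex) \<Rightarrow> (complex \<Rightarrow> complex) \<Rightarrow> complex" where
  "ip \<beta> f g = (LINT z|lborel. f z * cnj (g z) * of_real (weight \<beta> z))"

definition bergman_kernel :: "real \<Rightarrow> complex \<Rightarrow> complex \<Rightarrow> complex" where
  "bergman_kernel \<beta> z w = (THE k. k \<in> H \<beta> \<and> (\<forall>f\<in>H \<beta>. f w = ip \<beta> f k)) z"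

text \<open>The number under the root is a positive real, so the principal complex root is the
  usual one.\<close>

definition normalized_kernel :: "real \<Rightarrow> complex \<Rightarrow> complex \<Rightarrow> complex" where
  "normalized_kernel \<beta> w z = bergman_kernel \<beta> z w / csqrt (bergman_kernel \<beta> w w)"

text \<open>An unbounded operator on \<^term>\<open>H \<beta>\<close> is given by its domain \<open>D\<close> and a map \<open>T\<close> whose
  values outside \<open>D\<close> are irrelevant. The value of the adjoint is unique when \<open>D\<close> is dense.\<close>

definition adjoint_dom ::
    "real \<Rightarrow> (complex \<Rightarrow> complex) set \<Rightarrow> ((complex \<Rightarrow> complex) \<Rightarrow> (complex \<Rightarrow> complex))
      \<Rightarrow> (complex \<Rightarrow> complex) set" where
  "adjoint_dom \<beta> D T = {g \<in> H \<beta>. \<exists>h\<in>H \<beta>. \<forall>f\<in>D. ip \<beta> (T f) g = ip \<beta> f h}"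

definition adjoint_op ::
    "real \<Rightarrow> (complex \<Rightarrow> complex) set \<Rightarrow> ((complex \<Rightarrow> complex) \<Rightarrow> (complex \<Rightarrow> complex))
      \<Rightarrow> (complex \<Rightarrow> complex) \<Rightarrow> (complex \<Rightarrow> complex)" where
  "adjoint_op \<beta> D T g = (THE h. h \<in> H \<beta> \<and> (\<forall>f\<in>D. ip \<beta> (T f) g = ip \<beta> f h))"

definition berezin ::
    "real \<Rightarrow> ((complex \<Rightarrow> complex) \<Rightarrow> (complex \<Rightarrow> complex)) \<Rightarrow> complex \<Rightarrow> complex" where
  "berezin \<beta> T w = ip \<beta> (T (normalized_kernel \<beta> w)) (normalized_kernel \<beta> w)"

definition a_dom :: "real \<Rightarrow> (complex \<Rightarrow> complex) set" where
  "a_dom \<beta> = {f \<in> H \<beta>. deriv f \<in> H \<beta>}"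

definition a_op :: "(complex \<Rightarrow> complex) \<Rightarrow> (complex \<Rightarrow> complex)" where
  "a_op f = deriv f"

abbreviation a_star_dom :: "real \<Rightarrow> (complex \<Rightarrow> complex) set" where
  "a_star_dom \<beta> \<equiv> adjoint_dom \<beta> (a_dom \<beta>) a_op"

abbreviation a_star :: "real \<Rightarrow> (complex \<Rightarrow> complex) \<Rightarrow> (complex \<Rightarrow> complex)" where
  "a_star \<beta> \<equiv> adjoint_op \<beta> (a_dom \<beta>) a_op"

end

(* Write f in H_beta as exp(beta z^2/2) F; then F ranges over the Fock space H_0 of weight
   exp(-|z|^2). On H_0, translate the point w to the origin and average over rotations: by Cauchy's
   formulas, pairing F with exp(z cnj w) and with z exp(z cnj w) gives C F(w) and C F'(w), where
   C is the integral of exp(-|z|^2). Hence the kernel of H_beta is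
   K_w(z) = exp(beta z^2/2 + z cnj w + beta (cnj w)^2/2) / C, so that
   a K_w = (beta z + cnj w) K_w, and a* K_w = (z + beta cnj w) K_w because pairing with the latter
   is f -> f'(w). Both Berezin transforms follow by evaluating at z = w. *)
theory Submission
  imports Defs "HOL-Probability.Distributions"
begin

section \<open>Gaussian integrals and rotation invariance of Lebesgue measure\<close>

text \<open>Tonelli over real and imaginary parts reduces this to the one-dimensional standard
  normal density. The halved exponent is the form needed later as a majorant: it leaves half of the
  Fock weight's decay to absorb exponential growth.\<close>

lemma integrable_gaussian:
  "integrable lborel (\<lambda>z::complex. exp (- (cmod z)\<^sup>2 / 2))"
proof (rule integrableI_nonneg)
  have g: "(\<integral>\<^sup>+x. ennreal (exp (- x\<^sup>2 / 2)) \<partial>lborel) < \<infinity>" (is "?g < _")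
  proof -
    have "integrable lborel (\<lambda>x. sqrt (2 * pi) * std_normal_density x)"
      using integrable_normal_density by (intro integrable_mult_right) auto
    then have "integrable lborel (\<lambda>x::real. exp (- x\<^sup>2 / 2))"
      by (simp add: std_normal_density_def)
    then show ?thesis
      by (simp add: integrable_iff_bounded)
  qed
  have "(\<integral>\<^sup>+z. ennreal (exp (- (cmod z)\<^sup>2 / 2)) \<partial>lborel)
      = (\<integral>\<^sup>+z. (\<Prod>b\<in>Basis. ennreal (exp (- (z \<bullet> b)\<^sup>2 / 2))) \<partial>(lborel :: complex measure))"
    by (intro nn_integral_cong)
       (simp add: Basis_complex_def prod_ennreal cmod_power2 flip: ennreal_mult exp_add add: field_simps)
  also have "\<dots> = (\<Prod>b\<in>(Basis::complex set). ?g)"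
    by (rule nn_integral_lborel_prod) auto
  also have "\<dots> < \<infinity>"
    using g by (simp add: ennreal_mult_less_top power2_eq_square)
  finally show "(\<integral>\<^sup>+z. ennreal (exp (- (cmod z)\<^sup>2 / 2)) \<partial>lborel) < \<infinity>" .
qed auto

lemma integrable_gaussian_unscaled: "integrable lborel (\<lambda>z::complex. exp (- (cmod z)\<^sup>2))"
  by (rule Bochner_Integration.integrable_bound[OF integrable_gaussian]) auto

text \<open>The number pi, kept symbolic: it enters the kernel as a normalising constant and cancels
  there.\<close>

definition gauss_mass :: real where
  "gauss_mass = (LINT z|(lborel :: complex measure). exp (- (cmod z)\<^sup>2))"

lemma gauss_mass_pos: "0 < gauss_mass"
proof -
  \<comment> \<open>A nonnegative integrand with zero integral vanishes almost everywhere, but this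
    one is positive everywhere and Lebesgue measure is nonzero.\<close>
  have "gauss_mass \<noteq> 0"
    unfolding gauss_mass_def
    by (subst integral_nonneg_eq_0_iff_AE[OF integrable_gaussian_unscaled])
       (auto simp: ae_filter_eq_bot_iff simp flip: trivial_limit_def)
  moreover have "0 \<le> gauss_mass"
    by (simp add: gauss_mass_def)
  ultimately show ?thesis
    by linarith
qed

lemma nn_integral_lborel_translate:
  fixes c :: "'a::euclidean_space"
  assumes [measurable]: "f \<in> borel_measurable borel"
  shows "(\<integral>\<^sup>+x. f (c + x) \<partial>lborel) = (\<integral>\<^sup>+x. f x \<partial>lborel)"
  by (subst (2) lborel_distr_plus[of c, symmetric]) (simp add: nn_integral_distr)

text \<open>Uniqueness of Haar measure, with the rotation invariant Gaussian as the test function.\<close>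

lemma nn_integral_rotate_uminus:
  fixes c :: complex
  assumes c: "cmod c = 1" and [measurable]: "f \<in> borel_measurable borel"
  shows "(\<integral>\<^sup>+x. f (c * x) \<partial>lborel) = (\<integral>\<^sup>+x. f (- x) \<partial>lborel)"
proof -
  define g where "g = (\<lambda>z. ennreal (exp (- (cmod z)\<^sup>2)))"
  have [measurable]: "g \<in> borel_measurable borel"
    by (auto simp: g_def)
  have c0: "c \<noteq> 0" using c by auto
  let ?I = "\<lambda>f. (\<integral>\<^sup>+x. f x \<partial>(lborel :: complex measure))"
  have fub: "(\<integral>\<^sup>+x. (\<integral>\<^sup>+y. h x y \<partial>lborel) \<partial>lborel) = (\<integral>\<^sup>+y. (\<integral>\<^sup>+x. h x y \<partial>lborel) \<partial>lborel)"
    if [measurable]: "case_prod h \<in> borel_measurable (borel \<Otimes>\<^sub>M borel)"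
    for h :: "complex \<Rightarrow> complex \<Rightarrow> ennreal"
    by (rule lborel_pair.Fubini'[symmetric]) simp
  have "?I (\<lambda>x. f (c * x)) * ?I g = (\<integral>\<^sup>+x. (\<integral>\<^sup>+y. f (c * x) * g y \<partial>lborel) \<partial>lborel)"
    by (simp add: nn_integral_cmult nn_integral_multc)
  also have "\<dots> = (\<integral>\<^sup>+x. (\<integral>\<^sup>+y. f (c * x) * g (c * x + y) \<partial>lborel) \<partial>lborel)"
    by (intro nn_integral_cong nn_integral_lborel_translate[symmetric]) simp
  also have "\<dots> = (\<integral>\<^sup>+y. (\<integral>\<^sup>+x. f (c * x) * g (c * x + y) \<partial>lborel) \<partial>lborel)"
    by (rule fub) simp
  \<comment> \<open>The shift by \<open>- y / c\<close> is chosen so that the argument of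
    \<open>g\<close> becomes \<open>c * x\<close>; rotation invariance of \<open>g\<close> then
    removes \<open>c\<close>.\<close>
  also have "\<dots> = (\<integral>\<^sup>+y. (\<integral>\<^sup>+x. f (c * (- y / c + x)) * g (c * (- y / c + x) + y) \<partial>lborel) \<partial>lborel)"
    by (intro nn_integral_cong nn_integral_lborel_translate[symmetric]) simp
  also have "\<dots> = (\<integral>\<^sup>+y. (\<integral>\<^sup>+x. f (c * x - y) * g x \<partial>lborel) \<partial>lborel)"
  proof -
    have e: "c * (- y / c + x) = c * x - y" for x y
      using c0 by (simp add: field_simps)
    then show ?thesis
      unfolding e using c by (simp add: g_def norm_mult)
  qed
  also have "\<dots> = (\<integral>\<^sup>+x. (\<integral>\<^sup>+y. f (c * x - y) * g x \<partial>lborel) \<partial>lborel)"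
    by (rule fub[symmetric]) simp
  also have "\<dots> = (\<integral>\<^sup>+x. (\<integral>\<^sup>+y. f (- y) * g x \<partial>lborel) \<partial>lborel)"
  proof (rule nn_integral_cong)
    fix x show "(\<integral>\<^sup>+y. f (c * x - y) * g x \<partial>lborel) = (\<integral>\<^sup>+y. f (- y) * g x \<partial>lborel)"
      by (subst nn_integral_lborel_translate[of _ "c * x", symmetric]) auto
  qed
  also have "\<dots> = ?I (\<lambda>y. f (- y)) * ?I g"
    by (simp add: nn_integral_cmult nn_integral_multc)
  finally have eq: "?I (\<lambda>x. f (c * x)) * ?I g = ?I (\<lambda>y. f (- y)) * ?I g" .
  \<comment> \<open>Cancelling the factor \<open>?I g\<close> in \<open>ennreal\<close> requires it
    to be neither zero nor infinite.\<close>
  have "?I g = ennreal gauss_mass"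
    unfolding g_def gauss_mass_def by (rule nn_integral_eq_integral[OF integrable_gaussian_unscaled]) simp
  then have "?I g \<noteq> 0" "?I g \<noteq> top"
    using gauss_mass_pos by (auto simp: ennreal_eq_0_iff)
  then show ?thesis
    using eq by (metis mult_divide_eq_ennreal)
qed

lemma lborel_distr_rotation:
  fixes c :: complex
  assumes c: "cmod c = 1"
  shows "distr lborel borel ((*) c) = lborel"
proof (rule measure_eqI)
  fix A :: "complex set" assume "A \<in> sets (distr lborel borel ((*) c))"
  then have [measurable]: "A \<in> sets borel" by simp
  have "emeasure (distr lborel borel ((*) c)) A = (\<integral>\<^sup>+x. indicator A x \<partial>distr lborel borel ((*) c))"
    by simp
  also have "\<dots> = (\<integral>\<^sup>+x. indicator A (c * x) \<partial>lborel)"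
    by (rule nn_integral_distr) auto
  \<comment> \<open>The instance with multiplier 1 undoes the reflection: both sides equal the
    integral of the reflected indicator.\<close>
  also have "\<dots> = (\<integral>\<^sup>+x. indicator A x \<partial>lborel)"
    using nn_integral_rotate_uminus[OF c, of "indicator A"] nn_integral_rotate_uminus[of 1 "indicator A"]
    by simp
  finally show "emeasure (distr lborel borel ((*) c)) A = emeasure lborel A"
    by simp
qed simp

section \<open>Averaging over rotations by Cauchy's formulas\<close>

lemma integral_circle_mean:
  assumes G: "G holomorphic_on UNIV"
  shows "((\<lambda>t. G (exp (2 * of_real pi * \<i> * of_real t) * u)) has_integral G 0) {0..1}"
proof -
  have "(\<lambda>z. G (z * u)) holomorphic_on cball 0 1"
    by (intro holomorphic_on_compose_gen[OF _ G, unfolded o_def] holomorphic_intros) auto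
  from Cauchy_integral_circlepath_simple[OF this, of 0]
  have "((\<lambda>z. G (z * u) / z) has_contour_integral 2 * of_real pi * \<i> * G 0) (circlepath 0 1)"
    by simp
  \<comment> \<open>On the unit circle parametrised by
    \<open>exp (2 * of_real pi * \<i> * of_real t)\<close>, dz / z is 2 pi i dt.\<close>
  then have "((\<lambda>t. 2 * of_real pi * \<i> * G (exp (2 * of_real pi * \<i> * of_real t) * u)) has_integral 2 * of_real pi * \<i> * G 0) {0..1}"
    unfolding has_contour_integral
    by (rule has_integral_eq[rotated]) (simp only: vector_derivative_circlepath, simp add: circlepath mult_ac)
  from has_integral_mult_right[OF this, of "1 / (2 * of_real pi * \<i>)"] show ?thesis
    by simp
qed

text \<open>Cauchy's formula for the first derivative of \<open>G (z * u)\<close> at 0. Of the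
  factor 1 / z^2, one power of 1 / z is used up by dz; the other remains and later plays the role of
  the conjugate of z, with which it agrees on the unit circle.\<close>

lemma integral_circle_mean_deriv:
  assumes G: "G holomorphic_on UNIV"
  shows "((\<lambda>t. G (exp (2 * of_real pi * \<i> * of_real t) * u) / exp (2 * of_real pi * \<i> * of_real t))
           has_integral u * deriv G 0) {0..1}"
proof -
  have h: "(\<lambda>z. G (z * u)) holomorphic_on UNIV"
    by (intro holomorphic_on_compose_gen[OF _ G, unfolded o_def] holomorphic_intros) auto
  have d: "((\<lambda>z. G (z * u)) has_field_derivative deriv G 0 * u) (at 0)"
    using holomorphic_derivI[OF G open_UNIV UNIV_I, of 0]
    by (auto intro!: DERIV_chain'[where g=G, OF _ _] derivative_eq_intros)
  have c: "continuous_on (cball 0 1) (\<lambda>z. G (z * u))" "(\<lambda>z. G (z * u)) holomorphic_on ball 0 1"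
    using h by (auto intro: holomorphic_on_imp_continuous_on holomorphic_on_subset)
  note C = Cauchy_derivative_integral_circlepath[OF c, of 0, simplified]
  have "contour_integral (circlepath 0 1) (\<lambda>z. G (z * u) / z^2) = 2 * of_real pi * \<i> * (deriv G 0 * u)"
    using DERIV_unique[OF d C(2)] by (simp add: field_simps)
  with has_contour_integral_integral[OF C(1)]
  have "((\<lambda>z. G (z * u) / z^2) has_contour_integral 2 * of_real pi * \<i> * (deriv G 0 * u)) (circlepath 0 1)"
    by simp
  then have "((\<lambda>t. 2 * of_real pi * \<i> * (G (exp (2 * of_real pi * \<i> * of_real t) * u) / exp (2 * of_real pi * \<i> * of_real t)))
      has_integral 2 * of_real pi * \<i> * (deriv G 0 * u)) {0..1}"
    unfolding has_contour_integral
    by (rule has_integral_eq[rotated]) (simp only: vector_derivative_circlepath, simp add: circlepath field_simps power2_eq_square)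
  from has_integral_mult_right[OF this, of "1 / (2 * of_real pi * \<i>)"] show ?thesis
    by (simp add: mult_ac)
qed

text \<open>Rotating the integrand does not change its integral over the plane, so averaging over
  all rotations does not either; Fubini moves the average inside.\<close>

lemma lborel_integral_circle_mean:
  fixes \<Phi> M :: "complex \<Rightarrow> complex"
  assumes cont: "continuous_on UNIV \<Phi>" and int: "integrable lborel \<Phi>"
    and M: "\<And>u. ((\<lambda>t. \<Phi> (exp (2 * of_real pi * \<i> * of_real t) * u)) has_integral M u) {0..1}"
  shows "(LINT u|lborel. \<Phi> u) = (LINT u|lborel. M u)"
proof -
  define e where "e = (\<lambda>t::real. exp (2 * of_real pi * \<i> * of_real t))"
  have ne: "cmod (e t) = 1" for t
    by (simp add: e_def norm_exp_eq_Re)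
  have ce: "continuous_on S e" for S
    unfolding e_def by (intro continuous_intros)
  have [measurable]: "\<Phi> \<in> borel_measurable borel" "e \<in> borel_measurable borel"
    using cont ce by (auto intro: borel_measurable_continuous_onI)
  define h where "h = (\<lambda>(t::real) u. indicator {0..1} t *\<^sub>R \<Phi> (e t * u))"
  have rot: "integrable lborel (\<lambda>u. \<Phi> (e t * u))" "(LINT u|lborel. \<Phi> (e t * u)) = (LINT u|lborel. \<Phi> u)"
     "(LINT u|lborel. cmod (\<Phi> (e t * u))) = (LINT u|lborel. cmod (\<Phi> u))" for t
    using int integrable_distr_eq[of "(*) (e t)" lborel borel \<Phi>] integral_distr[of "(*) (e t)" lborel borel \<Phi>]
       integral_distr[of "(*) (e t)" lborel borel "\<lambda>u. cmod (\<Phi> u)"]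
    by (simp_all add: lborel_distr_rotation[OF ne])
  have i01: "integrable lborel (\<lambda>t::real. indicator {0..1} t *\<^sub>R c)" "(LINT t|lborel. indicator {0..1::real} t *\<^sub>R c) = c"
    for c :: "'b::{banach,second_countable_topology}"
    by auto
  \<comment> \<open>By rotation invariance the inner integral of the norm is the same for every t in
    [0, 1], and the indicator cuts off the rest.\<close>
  have "integrable (lborel \<Otimes>\<^sub>M lborel) (case_prod h)"
  proof (rule lborel_pair.Fubini_integrable)
    show "case_prod h \<in> borel_measurable (lborel \<Otimes>\<^sub>M lborel)"
      unfolding h_def by simp
    show "integrable lborel (\<lambda>t. LINT u|lborel. cmod (case (t, u) of (t, u) \<Rightarrow> h t u))"
      using i01(1)[of "LINT u|lborel. cmod (\<Phi> u)"] by (simp add: h_def rot)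
    show "AE t in lborel. integrable lborel (\<lambda>u. case (t, u) of (t, u) \<Rightarrow> h t u)"
      by (simp add: h_def rot)
  qed
  from lborel_pair.Fubini_integral[OF this]
  have eq: "(LINT u|lborel. LINT t|lborel. h t u) = (LINT t|lborel. LINT u|lborel. h t u)" .
  \<comment> \<open>The assumption on \<open>M\<close> concerns the gauge integral; continuity on a
    compact interval identifies it with the Lebesgue integral.\<close>
  have Mu: "(LINT t|lborel. h t u) = M u" for u
  proof -
    have "set_integrable lborel {0..1} (\<lambda>t. \<Phi> (e t * u))"
      by (intro borel_integrable_compact[unfolded set_integrable_def[symmetric]]
        continuous_on_compose2[OF cont] continuous_intros ce) auto
    from set_borel_integral_eq_integral(2)[OF this] M[of u] show ?thesis
      by (simp add: h_def set_lebesgue_integral_def e_def integral_unique)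
  qed
  have "(LINT t|lborel. LINT u|lborel. h t u) = (LINT u|lborel. \<Phi> u)"
    using i01(2)[of "LINT u|lborel. \<Phi> u"] by (simp add: h_def rot)
  then show ?thesis using eq by (simp add: Mu)
qed

section \<open>Point evaluations on the Fock space\<close>

lemma weight_zero: "weight 0 z = exp (- (cmod z)\<^sup>2)"
  by (simp add: weight_def cmod_power2)

lemma weight_nonneg [simp]: "0 \<le> weight \<beta> z"
  by (simp add: weight_def)

lemma measurable_weight [measurable]: "weight \<beta> \<in> borel_measurable borel"
  unfolding weight_def by measurable

lemma complex_of_real_weight_zero: "of_real (weight 0 z) = exp (- (z * cnj z))"
  by (simp add: weight_zero complex_mult_cnj cmod_power2 flip: exp_of_real)

lemma H_holomorphic: "f \<in> H \<beta> \<Longrightarrow> f holomorphic_on UNIV"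
  by (simp add: H_def)

lemma holomorphic_measurable: "f holomorphic_on UNIV \<Longrightarrow> f \<in> borel_measurable borel"
  by (intro borel_measurable_continuous_onI holomorphic_on_imp_continuous_on)

lemma measurable_cnj [measurable]: "cnj \<in> borel_measurable borel"
  by (intro borel_measurable_continuous_onI continuous_intros)

lemma H_ip_integrable:
  assumes "f \<in> H \<beta>" "g \<in> H \<beta>"
  shows "integrable lborel (\<lambda>z. f z * cnj (g z) * of_real (weight \<beta> z))"
proof (rule Bochner_Integration.integrable_bound)
  show "integrable lborel (\<lambda>z. (cmod (f z))\<^sup>2 * weight \<beta> z + (cmod (g z))\<^sup>2 * weight \<beta> z)"
    using assms by (auto simp: H_def)
  have [measurable]: "f \<in> borel_measurable borel" "g \<in> borel_measurable borel"
    using assms by (auto intro: holomorphic_measurable H_holomorphic)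
  show "(\<lambda>z. f z * cnj (g z) * of_real (weight \<beta> z)) \<in> borel_measurable lborel"
    by measurable
  have "cmod (f z) * cmod (g z) \<le> (cmod (f z))\<^sup>2 + (cmod (g z))\<^sup>2" for z
  proof -
    have "0 \<le> cmod (f z) * cmod (g z)"
      by simp
    then show ?thesis
      using sum_squares_bound[of "cmod (f z)" "cmod (g z)"] by linarith
  qed
  then show "AE z in lborel. cmod (f z * cnj (g z) * of_real (weight \<beta> z))
       \<le> norm ((cmod (f z))\<^sup>2 * weight \<beta> z + (cmod (g z))\<^sup>2 * weight \<beta> z)"
    by (auto simp: norm_mult distrib_right[symmetric] intro!: mult_right_mono)
qed

lemma ip_cnj: "ip \<beta> g f = cnj (ip \<beta> f g)"
  unfolding ip_def by (subst Bochner_Integration.integral_cnj[symmetric]) (simp add: mult_ac)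

lemma ip_scale_right: "ip \<beta> f (\<lambda>z. c * g z) = cnj c * ip \<beta> f g"
proof -
  have "ip \<beta> f (\<lambda>z. c * g z) = (LINT z|lborel. cnj c * (f z * cnj (g z) * of_real (weight \<beta> z)))"
    by (simp add: ip_def mult_ac)
  then show ?thesis
    by (simp add: ip_def)
qed

lemma ip_add_right:
  assumes "f \<in> H \<beta>" "g \<in> H \<beta>" "h \<in> H \<beta>"
  shows "ip \<beta> f (\<lambda>z. g z + h z) = ip \<beta> f g + ip \<beta> f h"
  using Bochner_Integration.integral_add[OF H_ip_integrable[OF assms(1,2)] H_ip_integrable[OF assms(1,3)]]
  by (simp add: ip_def algebra_simps)

lemma H_scale: "f \<in> H \<beta> \<Longrightarrow> (\<lambda>z. c * f z) \<in> H \<beta>"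
  by (auto simp: H_def norm_mult power_mult_distrib mult.assoc intro!: holomorphic_intros)

lemma exponential_growth_in_Fock:
  assumes hol: "f holomorphic_on UNIV" and B: "\<And>z. cmod (f z) \<le> exp (A + B * cmod z)"
  shows "f \<in> H 0"
proof -
  have [measurable]: "f \<in> borel_measurable borel"
    using hol by (rule holomorphic_measurable)
  have "integrable lborel (\<lambda>z. (cmod (f z))\<^sup>2 * weight 0 z)"
  proof (rule Bochner_Integration.integrable_bound)
    show "integrable lborel (\<lambda>z. exp (2 * A + 2 * B\<^sup>2) * exp (- (cmod z)\<^sup>2 / 2))"
      by (intro integrable_mult_right integrable_gaussian)
    have "(cmod (f z))\<^sup>2 * weight 0 z \<le> exp (2 * A + 2 * B\<^sup>2) * exp (- (cmod z)\<^sup>2 / 2)" for z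
    proof -
      have "(cmod (f z))\<^sup>2 * weight 0 z \<le> (exp (A + B * cmod z))\<^sup>2 * weight 0 z"
        by (intro mult_right_mono power_mono B) auto
      also have "\<dots> = exp (2 * (A + B * cmod z) - (cmod z)\<^sup>2)"
        by (simp add: weight_zero flip: exp_double exp_add)
      \<comment> \<open>Completing the square: 2 B |z| <= 2 B^2 + |z|^2 / 2 is equivalent to (|z| -
        2 B)^2 >= 0.\<close>
      also have "\<dots> \<le> exp (2 * A + 2 * B\<^sup>2 - (cmod z)\<^sup>2 / 2)"
        using zero_le_power2[of "cmod z - 2 * B"] by (simp add: power2_eq_square algebra_simps)
      finally show ?thesis
        by (simp flip: exp_add)
    qed
    then show "AE z in lborel. norm ((cmod (f z))\<^sup>2 * weight 0 z)
        \<le> norm (exp (2 * A + 2 * B\<^sup>2) * exp (- (cmod z)\<^sup>2 / 2))"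
      by simp
  qed simp
  then show ?thesis
    using hol by (simp add: H_def)
qed

text \<open>One family covers everything needed: the Fock kernels, their multiples by z, and, after
  transfer to \<open>H \<beta>\<close>, the images of the kernels under \<open>a\<close> and its
  adjoint.\<close>

lemma linear_mult_exp_in_Fock: "(\<lambda>z. (a * z + b) * exp (z * c)) \<in> H 0"
proof (rule exponential_growth_in_Fock)
  fix z
  have "cmod (a * z + b) \<le> cmod a * cmod z + cmod b"
    by (metis norm_mult norm_triangle_ineq)
  also have "\<dots> \<le> exp (cmod b + cmod a * cmod z)"
    using exp_ge_add_one_self[of "cmod b + cmod a * cmod z"] by linarith
  finally have 1: "cmod (a * z + b) \<le> exp (cmod b + cmod a * cmod z)" .
  have "Re (z * c) \<le> cmod z * cmod c"
    by (metis complex_Re_le_cmod norm_mult)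
  then have 2: "cmod (exp (z * c)) \<le> exp (cmod c * cmod z)"
    by (simp add: norm_exp_eq_Re mult.commute)
  show "cmod ((a * z + b) * exp (z * c)) \<le> exp (cmod b + (cmod a + cmod c) * cmod z)"
    unfolding norm_mult
    by (rule order_trans[OF mult_mono[OF 1 2]]) (simp_all add: algebra_simps flip: exp_add)
qed (intro holomorphic_intros)

lemma exp_in_Fock: "(\<lambda>z. exp (z * c)) \<in> H 0" and times_exp_in_Fock: "(\<lambda>z. z * exp (z * c)) \<in> H 0"
  using linear_mult_exp_in_Fock[of 0 1 c] linear_mult_exp_in_Fock[of 1 0 c] by simp_all

section \<open>Translation to the origin and the reproducing formulas on Fock space\<close>

lemma lborel_integral_translate:
  fixes f :: "'a::euclidean_space \<Rightarrow> 'b::{banach,second_countable_topology}"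
  assumes [measurable]: "f \<in> borel_measurable borel"
  shows "(LINT u|lborel. f (c + u)) = (LINT u|lborel. f u)"
    and "integrable lborel (\<lambda>u. f (c + u)) = integrable lborel f"
  using integral_distr[of "(+) c" lborel borel f] integrable_distr_eq[of "(+) c" lborel borel f]
  by (simp_all add: lborel_distr_plus)

text \<open>Substitute z = w + u. The conjugated kernel cancels the non-holomorphic cross term of |w
  + u|^2, so besides the weight in u only the holomorphic factor \<open>exp (- (cnj w * u))\<close>
  remains. For the second pairing, the extra factor cnj z splits as cnj w + cnj u.\<close>

lemma Fock_translate:
  assumes F: "F \<in> H 0"
  defines "G \<equiv> \<lambda>w u. F (w + u) * exp (- (cnj w * u))"
  shows "integrable lborel (\<lambda>u. G w u * of_real (weight 0 u))"
    and "integrable lborel (\<lambda>u. cnj u * G w u * of_real (weight 0 u))"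
    and "ip 0 F (\<lambda>z. exp (z * cnj w)) = (LINT u|lborel. G w u * of_real (weight 0 u))"
    and "ip 0 F (\<lambda>z. z * exp (z * cnj w)) =
      cnj w * (LINT u|lborel. G w u * of_real (weight 0 u)) + (LINT u|lborel. cnj u * G w u * of_real (weight 0 u))"
proof -
  have [measurable]: "F \<in> borel_measurable borel"
    using F by (auto intro: holomorphic_measurable H_holomorphic)
  have e: "exp (cnj (w + u) * w) * of_real (weight 0 (w + u)) = exp (- (cnj w * u)) * of_real (weight 0 u)" for u
    by (simp add: complex_of_real_weight_zero algebra_simps flip: exp_add)
  have G: "F (w + u) * cnj (exp ((w + u) * cnj w)) * of_real (weight 0 (w + u)) = G w u * of_real (weight 0 u)" for u
    using e[of u] by (simp add: G_def exp_cnj mult.assoc)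
  have G': "F (w + u) * cnj ((w + u) * exp ((w + u) * cnj w)) * of_real (weight 0 (w + u))
      = cnj w * (G w u * of_real (weight 0 u)) + cnj u * G w u * of_real (weight 0 u)" for u
    using G[of u, symmetric] by (simp add: algebra_simps)
  have i: "integrable lborel (\<lambda>u. F (w + u) * cnj (exp ((w + u) * cnj w)) * of_real (weight 0 (w + u)))"
    using H_ip_integrable[OF F exp_in_Fock[of "cnj w"]]
    by (subst lborel_integral_translate(2)[where f="\<lambda>u. F u * cnj (exp (u * cnj w)) * of_real (weight 0 u)"]) auto
  have i': "integrable lborel (\<lambda>u. F (w + u) * cnj ((w + u) * exp ((w + u) * cnj w)) * of_real (weight 0 (w + u)))"
    using H_ip_integrable[OF F times_exp_in_Fock[of "cnj w"]]
    by (subst lborel_integral_translate(2)[where f="\<lambda>u. F u * cnj (u * exp (u * cnj w)) * of_real (weight 0 u)"]) auto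
  show 1: "integrable lborel (\<lambda>u. G w u * of_real (weight 0 u))"
    using i by (simp only: G)
  \<comment> \<open>By \<open>G'\<close> this is the translated integrand of the second pairing
    minus a multiple of the first.\<close>
  show 2: "integrable lborel (\<lambda>u. cnj u * G w u * of_real (weight 0 u))"
    using Bochner_Integration.integrable_diff[OF i'[unfolded G'] integrable_mult_right[OF 1, of "cnj w"]]
    by simp
  show "ip 0 F (\<lambda>z. exp (z * cnj w)) = (LINT u|lborel. G w u * of_real (weight 0 u))"
    unfolding ip_def
    by (subst lborel_integral_translate(1)[of _ w, symmetric], (measurable)[1]) (simp only: G)
  have "ip 0 F (\<lambda>z. z * exp (z * cnj w)) =
    (LINT u|lborel. cnj w * (G w u * of_real (weight 0 u)) + cnj u * G w u * of_real (weight 0 u))"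
    unfolding ip_def
    by (subst lborel_integral_translate(1)[of _ w, symmetric], (measurable)[1]) (simp only: G')
  then show "ip 0 F (\<lambda>z. z * exp (z * cnj w)) =
      cnj w * (LINT u|lborel. G w u * of_real (weight 0 u)) + (LINT u|lborel. cnj u * G w u * of_real (weight 0 u))"
    using Bochner_Integration.integral_add[OF integrable_mult_right[OF 1, of "cnj w"] 2] by simp
qed

text \<open>The weight is radial, so averaging over circles replaces \<open>G\<close> by its central
  value \<open>G 0\<close>.\<close>

lemma gaussian_mean_value:
  assumes G: "G holomorphic_on UNIV" and i: "integrable lborel (\<lambda>u. G u * of_real (weight 0 u))"
  shows "(LINT u|lborel. G u * of_real (weight 0 u)) = of_real gauss_mass * G 0"
proof -
  have "(LINT u|lborel. G u * of_real (weight 0 u)) = (LINT u|lborel. G 0 * of_real (weight 0 u))"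
  proof (rule lborel_integral_circle_mean)
    show "continuous_on UNIV (\<lambda>u. G u * of_real (weight 0 u))"
      unfolding weight_zero
      by (intro continuous_intros holomorphic_on_imp_continuous_on G)
    fix u
    show "((\<lambda>t. G (exp (2 * of_real pi * \<i> * of_real t) * u) * of_real (weight 0 (exp (2 * of_real pi * \<i> * of_real t) * u)))
        has_integral G 0 * of_real (weight 0 u)) {0..1}"
      using has_integral_mult_left[OF integral_circle_mean[OF G, of u], of "of_real (weight 0 u)"]
      by (simp add: weight_zero norm_mult norm_exp_eq_Re)
  qed (rule i)
  also have "\<dots> = of_real gauss_mass * G 0"
    by (simp add: gauss_mass_def weight_zero del: of_real_exp)
  finally show ?thesis .
qed

lemma gaussian_mean_value_deriv:
  assumes G: "G holomorphic_on UNIV" and i: "integrable lborel (\<lambda>u. cnj u * G u * of_real (weight 0 u))"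
  shows "(LINT u|lborel. cnj u * G u * of_real (weight 0 u)) =
    of_real (LINT u|lborel. (cmod u)\<^sup>2 * weight 0 u) * deriv G 0"
proof -
  have "(LINT u|lborel. cnj u * G u * of_real (weight 0 u)) = (LINT u|lborel. of_real ((cmod u)\<^sup>2 * weight 0 u) * deriv G 0)"
  proof (rule lborel_integral_circle_mean)
    show "continuous_on UNIV (\<lambda>u. cnj u * G u * of_real (weight 0 u))"
      unfolding weight_zero
      by (intro continuous_intros holomorphic_on_imp_continuous_on G)
    fix u
    define e where "e t = exp (2 * of_real pi * \<i> * of_real t)" for t :: real
    have e: "cmod (e t) = 1" for t
      by (simp add: e_def norm_exp_eq_Re)
    \<comment> \<open>This turns the rotated factor cnj u into the kernel of Cauchy's derivative
      formula; the average is u * cnj u = |u|^2 times the derivative at 0.\<close>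
    have "cnj (e t) = 1 / e t" for t
      using complex_div_cnj[of 1 "e t"] by (simp add: e)
    then have "((\<lambda>t. cnj (e t * u) * G (e t * u) * of_real (weight 0 (e t * u)))
        has_integral u * deriv G 0 * (cnj u * of_real (weight 0 u))) {0..1}"
      using has_integral_mult_left[OF integral_circle_mean_deriv[OF G, of u, folded e_def], of "cnj u * of_real (weight 0 u)"]
      by (simp add: weight_zero norm_mult e mult_ac del: of_real_exp)
    then show "((\<lambda>t. cnj (exp (2 * of_real pi * \<i> * of_real t) * u) * G (exp (2 * of_real pi * \<i> * of_real t) * u) * of_real (weight 0 (exp (2 * of_real pi * \<i> * of_real t) * u)))
        has_integral of_real ((cmod u)\<^sup>2 * weight 0 u) * deriv G 0) {0..1}"
      unfolding of_real_mult complex_norm_square by (simp only: e_def mult_ac)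
  qed (rule i)
  then show ?thesis by (simp only: integral_mult_left_zero integral_complex_of_real)
qed

lemma Fock_translate_holomorphic:
  assumes F: "F holomorphic_on UNIV"
  defines "G \<equiv> \<lambda>w u. F (w + u) * exp (- (cnj w * u))"
  shows "G w holomorphic_on UNIV" and "deriv (G w) 0 = deriv F w - cnj w * F w"
proof -
  show "G w holomorphic_on UNIV"
    unfolding G_def
    by (intro holomorphic_intros holomorphic_on_compose_gen[OF _ F, unfolded o_def]) auto
  have "(F has_field_derivative deriv F w) (at (w + 0))"
    using holomorphic_derivI[OF F open_UNIV UNIV_I] by simp
  then have "((\<lambda>u. F (w + u)) has_field_derivative deriv F w) (at 0)"
    by (simp only: DERIV_shift add.commute)
  then have "(G w has_field_derivative deriv F w - cnj w * F w) (at 0)"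
    unfolding G_def by (auto intro!: derivative_eq_intros)
  then show "deriv (G w) 0 = deriv F w - cnj w * F w"
    by (rule DERIV_imp_deriv)
qed

text \<open>The mean value property applied to the translate of \<open>F\<close>, whose value at 0
  is \<open>F w\<close>.\<close>

lemma Fock_reproducing:
  assumes F: "F \<in> H 0"
  shows "ip 0 F (\<lambda>z. exp (z * cnj w)) = of_real gauss_mass * F w"
  using gaussian_mean_value[OF Fock_translate_holomorphic(1)[OF H_holomorphic[OF F]] Fock_translate(1)[OF F], of w]
  by (simp add: Fock_translate(3)[OF F])

text \<open>Pairing \<^term>\<open>exp\<close> with the identity function in both orders compares the second moment
  with the mass, so the Gaussian integrals need not be evaluated.\<close>

lemma gaussian_second_moment:
  "(LINT u|(lborel :: complex measure). (cmod u)\<^sup>2 * weight 0 u) = gauss_mass"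
proof -
  note E = exp_in_Fock[of 1, simplified] and Z = times_exp_in_Fock[of 0, simplified]
  have "ip 0 exp (\<lambda>z. z) = (LINT u|lborel. cnj u * exp u * of_real (weight 0 u))"
    using Fock_translate(4)[OF E, of 0] by simp
  also have "\<dots> = of_real (LINT u|(lborel :: complex measure). (cmod u)\<^sup>2 * weight 0 u)"
    using gaussian_mean_value_deriv[of exp] Fock_translate(2)[OF E, of 0]
    by (simp add: holomorphic_on_exp DERIV_imp_deriv[OF DERIV_exp])
  finally have "complex_of_real (LINT u|(lborel :: complex measure). (cmod u)\<^sup>2 * weight 0 u) = cnj (ip 0 (\<lambda>z. z) exp)"
    by (simp add: ip_cnj[of 0 exp])
  \<comment> \<open>Here \<open>exp\<close> is the unnormalised Fock kernel at the point 1, where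
    the identity function takes the value 1.\<close>
  also have "\<dots> = of_real gauss_mass"
    using Fock_reproducing[OF Z, of 1] by simp
  finally show ?thesis
    by (simp only: of_real_eq_iff)
qed

text \<open>The translate has derivative \<open>deriv F w - cnj w * F w\<close> at 0; its second
  term cancels the contribution of cnj w from splitting cnj z. Equality of second moment and mass
  makes the cancellation exact.\<close>

lemma Fock_reproducing_deriv:
  assumes F: "F \<in> H 0"
  shows "ip 0 F (\<lambda>z. z * exp (z * cnj w)) = of_real gauss_mass * deriv F w"
proof -
  note hol = Fock_translate_holomorphic[OF H_holomorphic[OF F]]
  have "ip 0 F (\<lambda>z. z * exp (z * cnj w)) = cnj w * (of_real gauss_mass * F w)
      + of_real gauss_mass * (deriv F w - cnj w * F w)"
    unfolding Fock_translate(4)[OF F] gaussian_mean_value[OF hol(1) Fock_translate(1)[OF F]]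
      gaussian_mean_value_deriv[OF hol(1) Fock_translate(2)[OF F]] gaussian_second_moment hol(2)
    by simp
  then show ?thesis
    by (simp add: algebra_simps)
qed

section \<open>The reproducing kernel of \<^term>\<open>H \<beta>\<close>\<close>

text \<open>With Re (z^2) = x^2 - y^2, the exponent is -|z|^2 - \<beta> Re (z^2), so the weights
  differ by the squared modulus of a zero-free entire function.\<close>

lemma weight_factor:
  "complex_of_real (weight \<beta> z) =
    of_real (weight 0 z) * exp (- of_real \<beta> * z\<^sup>2 / 2) * cnj (exp (- of_real \<beta> * z\<^sup>2 / 2))"
proof -
  have "complex_of_real (- (1 + \<beta>) * (Re z)\<^sup>2 - (1 - \<beta>) * (Im z)\<^sup>2) =
      - (z * cnj z) + (- of_real \<beta> * z\<^sup>2 / 2) + cnj (- of_real \<beta> * z\<^sup>2 / 2)"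
    by (simp add: complex_eq_iff power2_eq_square algebra_simps)
  then show ?thesis
    unfolding complex_of_real_weight_zero exp_cnj
    by (simp only: weight_def exp_add flip: exp_of_real)
qed

lemma weight_factor_norm:
  "weight \<beta> z = weight 0 z * (cmod (exp (- of_real \<beta> * z\<^sup>2 / 2)))\<^sup>2"
proof -
  have "complex_of_real (weight \<beta> z) = of_real (weight 0 z * (cmod (exp (- of_real \<beta> * z\<^sup>2 / 2)))\<^sup>2)"
    by (simp only: weight_factor[of \<beta>] mult.assoc of_real_mult complex_norm_square)
  then show ?thesis
    by (simp only: of_real_eq_iff)
qed

lemma H_to_Fock:
  assumes "f \<in> H \<beta>"
  shows "(\<lambda>z. f z * exp (- of_real \<beta> * z\<^sup>2 / 2)) \<in> H 0"
  using assms weight_factor_norm[of \<beta>]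
  by (auto simp: H_def norm_mult power_mult_distrib mult_ac intro!: holomorphic_intros)

lemma H_from_Fock:
  assumes "P \<in> H 0"
  shows "(\<lambda>z. exp (of_real \<beta> * z\<^sup>2 / 2) * P z) \<in> H \<beta>"
proof -
  have "(cmod (exp (of_real \<beta> * z\<^sup>2 / 2) * P z))\<^sup>2 * weight \<beta> z = (cmod (P z))\<^sup>2 * weight 0 z" for z
  proof -
    have "(cmod (exp (of_real \<beta> * z\<^sup>2 / 2) * P z))\<^sup>2 * weight \<beta> z =
        (cmod (P z))\<^sup>2 * weight 0 z * (cmod (exp (of_real \<beta> * z\<^sup>2 / 2) * exp (- of_real \<beta> * z\<^sup>2 / 2)))\<^sup>2"
      by (simp only: weight_factor_norm[of \<beta> z] norm_mult power_mult_distrib mult_ac)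
    then show ?thesis
      by (simp flip: exp_add)
  qed
  then show ?thesis
    using assms by (auto simp: H_def intro!: holomorphic_intros)
qed

text \<open>Multiplication by \<open>exp (of_real \<beta> * z\<^sup>2 / 2)\<close> is unitary from
  Fock space onto \<open>H \<beta>\<close>; this form moves it across the pairing as its
  inverse.\<close>

lemma ip_from_Fock:
  "ip \<beta> f (\<lambda>z. exp (of_real \<beta> * z\<^sup>2 / 2) * P z) = ip 0 (\<lambda>z. f z * exp (- of_real \<beta> * z\<^sup>2 / 2)) P"
proof -
  have "f z * cnj (exp (of_real \<beta> * z\<^sup>2 / 2) * P z) * of_real (weight \<beta> z) =
      f z * exp (- of_real \<beta> * z\<^sup>2 / 2) * cnj (P z) * of_real (weight 0 z)" for z
  proof -
    have "f z * cnj (exp (of_real \<beta> * z\<^sup>2 / 2) * P z) * of_real (weight \<beta> z) =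
        f z * exp (- of_real \<beta> * z\<^sup>2 / 2) * cnj (P z) * of_real (weight 0 z) *
        cnj (exp (of_real \<beta> * z\<^sup>2 / 2) * exp (- of_real \<beta> * z\<^sup>2 / 2))"
      by (simp only: weight_factor[of \<beta> z] complex_cnj_mult mult_ac)
    then show ?thesis
      by (simp flip: exp_add)
  qed
  then show ?thesis
    by (simp only: ip_def)
qed

text \<open>The base point comes first, so that fixing it gives an element of
  \<open>H \<beta>\<close>. The product is grouped as the transfer factor times a scaled Fock
  kernel, matching \<open>H_from_Fock\<close> and \<open>ip_from_Fock\<close>. The constant in w
  compensates the transfer factor evaluated at w.\<close>

definition explicit_kernel :: "real \<Rightarrow> complex \<Rightarrow> complex \<Rightarrow> complex" where
  "explicit_kernel \<beta> w z = exp (of_real \<beta> * z\<^sup>2 / 2) *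
     (exp (of_real \<beta> * (cnj w)\<^sup>2 / 2) / of_real gauss_mass * exp (z * cnj w))"

lemma explicit_kernel_in_H: "explicit_kernel \<beta> w \<in> H \<beta>"
  unfolding explicit_kernel_def by (intro H_from_Fock H_scale exp_in_Fock)

lemma explicit_kernel_linear_in_H: "(\<lambda>z. (a * z + b) * explicit_kernel \<beta> w z) \<in> H \<beta>"
proof -
  have "(\<lambda>z. exp (of_real \<beta> * z\<^sup>2 / 2) *
     (exp (of_real \<beta> * (cnj w)\<^sup>2 / 2) / of_real gauss_mass * ((a * z + b) * exp (z * cnj w)))) \<in> H \<beta>"
    by (intro H_from_Fock H_scale linear_mult_exp_in_Fock)
  then show ?thesis
    by (simp add: explicit_kernel_def mult_ac)
qed

lemma deriv_explicit_kernel: "deriv (explicit_kernel \<beta> w) = (\<lambda>z. (of_real \<beta> * z + cnj w) * explicit_kernel \<beta> w z)"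
proof -
  have "((\<lambda>z. exp (of_real \<beta> * z\<^sup>2 / 2) * (c * exp (z * cnj w))) has_field_derivative
      (of_real \<beta> * z + cnj w) * (exp (of_real \<beta> * z\<^sup>2 / 2) * (c * exp (z * cnj w)))) (at z)" for c z
    by (auto intro!: derivative_eq_intros simp: algebra_simps)
  then show ?thesis
    unfolding explicit_kernel_def by (intro ext DERIV_imp_deriv)
qed

lemma explicit_kernel_in_a_dom: "explicit_kernel \<beta> w \<in> a_dom \<beta>"
  using explicit_kernel_linear_in_H by (simp add: a_dom_def explicit_kernel_in_H deriv_explicit_kernel)

lemma ip_explicit_kernel:
  assumes f: "f \<in> H \<beta>"
  shows "ip \<beta> f (explicit_kernel \<beta> w) = f w"
proof -
  have "ip \<beta> f (explicit_kernel \<beta> w) = cnj (exp (of_real \<beta> * (cnj w)\<^sup>2 / 2) / of_real gauss_mass) *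
      (of_real gauss_mass * (f w * exp (- of_real \<beta> * w\<^sup>2 / 2)))"
    unfolding explicit_kernel_def ip_from_Fock ip_scale_right Fock_reproducing[OF H_to_Fock[OF f]] ..
  also have "\<dots> = f w * (exp (of_real \<beta> * w\<^sup>2 / 2) * exp (- of_real \<beta> * w\<^sup>2 / 2))"
    using gauss_mass_pos by (simp add: exp_cnj)
  finally show ?thesis
    by (simp flip: exp_add)
qed

text \<open>Supplies the value of the adjoint of \<open>a\<close> on kernels. On the Fock side, z
  yields the derivative of \<open>f z * e z\<close> at w, which contains the unwanted term
  \<open>- of_real \<beta> * w * f w * e w\<close>; the summand
  \<open>of_real \<beta> * cnj w\<close> is chosen so that its conjugate cancels it.\<close>

lemma ip_explicit_kernel_deriv:
  assumes f: "f \<in> H \<beta>"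
  shows "ip \<beta> f (\<lambda>z. (z + of_real \<beta> * cnj w) * explicit_kernel \<beta> w z) = deriv f w"
proof -
  define e where "e z = exp (- of_real \<beta> * z\<^sup>2 / 2)" for z :: complex
  note F = H_to_Fock[OF f, folded e_def]
  define P where "P z = exp (of_real \<beta> * (cnj w)\<^sup>2 / 2) / of_real gauss_mass *
      (z * exp (z * cnj w) + (of_real \<beta> * cnj w) * exp (z * cnj w))" for z
  have "(f has_field_derivative deriv f w) (at w)"
    using holomorphic_derivI[OF H_holomorphic[OF f] open_UNIV UNIV_I] .
  then have "((\<lambda>z. f z * e z) has_field_derivative (deriv f w * e w - of_real \<beta> * w * f w * e w)) (at w)"
    unfolding e_def by (auto intro!: derivative_eq_intros)
  then have d: "deriv (\<lambda>z. f z * e z) w = deriv f w * e w - of_real \<beta> * w * f w * e w"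
    by (rule DERIV_imp_deriv)
  have "ip \<beta> f (\<lambda>z. (z + of_real \<beta> * cnj w) * explicit_kernel \<beta> w z) = ip \<beta> f (\<lambda>z. exp (of_real \<beta> * z\<^sup>2 / 2) * P z)"
    by (simp add: P_def explicit_kernel_def algebra_simps add_divide_distrib)
  also have "\<dots> = ip 0 (\<lambda>z. f z * e z) P"
    by (simp only: ip_from_Fock e_def)
  also have "\<dots> = cnj (exp (of_real \<beta> * (cnj w)\<^sup>2 / 2) / of_real gauss_mass) *
      (of_real gauss_mass * (deriv f w * e w - of_real \<beta> * w * f w * e w)
       + cnj (of_real \<beta> * cnj w) * (of_real gauss_mass * (f w * e w)))"
    unfolding P_def ip_scale_right d[symmetric]
      ip_add_right[OF F times_exp_in_Fock H_scale[OF exp_in_Fock]]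
      Fock_reproducing_deriv[OF F] Fock_reproducing[OF F] ..
  also have "\<dots> = deriv f w * (exp (of_real \<beta> * w\<^sup>2 / 2) * exp (- of_real \<beta> * w\<^sup>2 / 2))"
    using gauss_mass_pos by (simp add: exp_cnj e_def field_simps)
  finally show ?thesis
    by (simp flip: exp_add)
qed

text \<open>Pairings with kernels are conjugated point values. Since the kernels also lie in
  \<open>a_dom \<beta>\<close>, this yields uniqueness both of the reproducing kernel and of the
  value of the adjoint.\<close>

lemma H_eqI:
  assumes g: "g \<in> H \<beta>" and h: "h \<in> H \<beta>" and eq: "\<And>u. ip \<beta> (explicit_kernel \<beta> u) g = ip \<beta> (explicit_kernel \<beta> u) h"
  shows "g = h"
proof
  fix u show "g u = h u"
    using arg_cong[OF eq[of u], of cnj] by (simp add: ip_explicit_kernel g h flip: ip_cnj)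
qed

lemma bergman_kernel_eq: "bergman_kernel \<beta> z w = explicit_kernel \<beta> w z"
proof -
  have "(THE k. k \<in> H \<beta> \<and> (\<forall>f\<in>H \<beta>. f w = ip \<beta> f k)) = explicit_kernel \<beta> w"
  proof (rule the_equality)
    fix k assume k: "k \<in> H \<beta> \<and> (\<forall>f\<in>H \<beta>. f w = ip \<beta> f k)"
    show "k = explicit_kernel \<beta> w"
    proof (rule H_eqI)
      show "ip \<beta> (explicit_kernel \<beta> u) k = ip \<beta> (explicit_kernel \<beta> u) (explicit_kernel \<beta> w)" for u
        using k explicit_kernel_in_H by (simp add: ip_explicit_kernel)
    qed (use k explicit_kernel_in_H in auto)
  qed (simp add: explicit_kernel_in_H ip_explicit_kernel)
  then show ?thesis
    by (simp add: bergman_kernel_def)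
qed

text \<open>The diagonal value of the kernel is a positive real r, so n = 1 / sqrt r is real and
  passes unchanged through the conjugate-linear slot. The second equation says that the normalised
  kernel has norm 1, in the shape in which the Berezin transforms produce it.\<close>

lemma normalized_kernel_eq:
  obtains n :: real where "normalized_kernel \<beta> w = (\<lambda>z. of_real n * explicit_kernel \<beta> w z)"
    and "of_real n * (of_real n * explicit_kernel \<beta> w w) = 1"
proof -
  define r where "r = exp (\<beta> * Re (w\<^sup>2) + (Re w)\<^sup>2 + (Im w)\<^sup>2) / gauss_mass"
  have r: "0 < r"
    using gauss_mass_pos by (simp add: r_def)
  \<comment> \<open>On the diagonal the two quadratic terms are conjugate to each other, hence the
    exponent is real.\<close>
  have "of_real \<beta> * w\<^sup>2 / 2 + of_real \<beta> * (cnj w)\<^sup>2 / 2 + w * cnj w = of_real (\<beta> * Re (w\<^sup>2) + (Re w)\<^sup>2 + (Im w)\<^sup>2)"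
    by (simp add: complex_eq_iff power2_eq_square algebra_simps)
  moreover have "explicit_kernel \<beta> w w =
      exp (of_real \<beta> * w\<^sup>2 / 2 + of_real \<beta> * (cnj w)\<^sup>2 / 2 + w * cnj w) / of_real gauss_mass"
    by (simp add: explicit_kernel_def exp_add)
  ultimately have k: "explicit_kernel \<beta> w w = of_real r"
    by (simp only: r_def exp_of_real of_real_divide)
  show thesis
  proof
    show "normalized_kernel \<beta> w = (\<lambda>z. of_real (1 / sqrt r) * explicit_kernel \<beta> w z)"
      using r by (simp add: fun_eq_iff normalized_kernel_def bergman_kernel_eq k csqrt_of_real_nonneg)
    have "1 / sqrt r * (1 / sqrt r * r) = 1"
      using r by (simp add: field_simps)
    then show "of_real (1 / sqrt r) * (of_real (1 / sqrt r) * explicit_kernel \<beta> w w) = 1"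
      unfolding k by (metis of_real_1 of_real_mult)
  qed
qed

section \<open>Berezin transforms of \<open>a\<close> and its adjoint\<close>

theorem mainTheorem2:
  fixes \<beta> :: real
  assumes "0 \<le> \<beta>" and "\<beta> \<le> 1"
  shows "\<forall>w :: complex.
      normalized_kernel \<beta> w \<in> a_dom \<beta> \<and>
      berezin \<beta> a_op w = of_real \<beta> * w + cnj w \<and>
      normalized_kernel \<beta> w \<in> a_star_dom \<beta> \<and>
      berezin \<beta> (a_star \<beta>) w = cnj (berezin \<beta> a_op w)"
proof
  fix w
  obtain n where k: "normalized_kernel \<beta> w = (\<lambda>z. of_real n * explicit_kernel \<beta> w z)"
    and n: "of_real n * (of_real n * explicit_kernel \<beta> w w) = 1"
    by (rule normalized_kernel_eq)
  let ?k = "normalized_kernel \<beta> w"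
  have ip_k: "ip \<beta> f ?k = of_real n * f w" if "f \<in> H \<beta>" for f
    using ip_explicit_kernel[OF that] by (simp add: k ip_scale_right)
  have kH: "?k \<in> H \<beta>"
    unfolding k by (intro H_scale explicit_kernel_in_H)
  have dk: "deriv ?k = (\<lambda>z. of_real n * deriv (explicit_kernel \<beta> w) z)"
    unfolding k
    by (intro ext deriv_cmult holomorphic_on_imp_differentiable_at[OF H_holomorphic[OF explicit_kernel_in_H] open_UNIV UNIV_I])
  have dom: "?k \<in> a_dom \<beta>"
    using explicit_kernel_in_a_dom by (simp add: a_dom_def kH dk H_scale)
  have a: "berezin \<beta> a_op w = of_real \<beta> * w + cnj w"
  proof -
    have "berezin \<beta> a_op w = (of_real \<beta> * w + cnj w) * (of_real n * (of_real n * explicit_kernel \<beta> w w))"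
      \<comment> \<open>Pairing with \<open>?k\<close> evaluates \<open>deriv ?k\<close> at w and
        multiplies by n.\<close>
      using dom by (simp add: berezin_def a_op_def a_dom_def ip_k) (simp add: dk deriv_explicit_kernel mult_ac)
    then show ?thesis
      by (simp only: n mult_1_right)
  qed
  \<comment> \<open>The candidate for the adjoint applied to \<open>?k\<close>: pairing f with it
    gives n times \<open>deriv f w\<close>, which is also the pairing of \<open>deriv f\<close> with
    \<open>?k\<close>.\<close>
  define h where "h = (\<lambda>z. of_real n * ((z + of_real \<beta> * cnj w) * explicit_kernel \<beta> w z))"
  have hH: "h \<in> H \<beta>"
    using explicit_kernel_linear_in_H[of 1 "of_real \<beta> * cnj w"] by (simp add: h_def H_scale)
  have h: "ip \<beta> (a_op f) ?k = ip \<beta> f h" if "f \<in> a_dom \<beta>" for f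
    using that by (simp add: a_op_def a_dom_def ip_k h_def ip_scale_right ip_explicit_kernel_deriv)
  have star_dom: "?k \<in> a_star_dom \<beta>"
    using kH hH h by (auto simp: adjoint_dom_def)
  have "a_star \<beta> ?k = h"
    unfolding adjoint_op_def
  proof (rule the_equality)
    fix g assume g: "g \<in> H \<beta> \<and> (\<forall>f\<in>a_dom \<beta>. ip \<beta> (a_op f) ?k = ip \<beta> f g)"
    \<comment> \<open>All kernels belong to \<open>a_dom \<beta>\<close>, so the adjoint equation
      may be tested on them.\<close>
    show "g = h"
    proof (rule H_eqI)
      show "ip \<beta> (explicit_kernel \<beta> u) g = ip \<beta> (explicit_kernel \<beta> u) h" for u
        using g h[OF explicit_kernel_in_a_dom] explicit_kernel_in_a_dom by simp
    qed (use g hH in auto)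
  qed (simp add: h hH)
  then have "berezin \<beta> (a_star \<beta>) w = (w + of_real \<beta> * cnj w) * (of_real n * (of_real n * explicit_kernel \<beta> w w))"
    by (simp add: berezin_def ip_k hH) (simp add: h_def mult_ac)
  then have "berezin \<beta> (a_star \<beta>) w = cnj (berezin \<beta> a_op w)"
    by (simp only: n a) simp
  with dom a star_dom show "?k \<in> a_dom \<beta> \<and> berezin \<beta> a_op w = of_real \<beta> * w + cnj w \<and>
      ?k \<in> a_star_dom \<beta> \<and> berezin \<beta> (a_star \<beta>) w = cnj (berezin \<beta> a_op w)"
    by blast
qed

end
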